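(* Let $0<\alpha\le 1$ and let $m,n$ be natural numbers. If $S$ is a solution on $(0,\infty)$ of the conformable Laguerre differential equation of order $m+n$, $$x^\alpha D^\alpha D^\alpha S+(\alpha-x^\alpha)D^\alpha S+(n+m)\alpha\, S=0,$$ then $y=D^{m\alpha}S$ is a solution on $(0,\infty)$ of the conformable associated Laguerre differential equation $$x^\alpha D^\alpha D^\alpha y+(m\alpha+\alpha-x^\alpha)D^\alpha y+n\alpha\, y=0.$$
   Context: For $0<\alpha\le 1$, the conformable derivative of order $\alpha$ of a function $f$ at $x>0$ is $D^\alpha f(x)=\lim_{\epsilon\to 0}\frac{f(x+\epsilon x^{1-\alpha})-f(x)}{\epsilon}$. $D^{m\alpha}$ denotes the $m$-fold composition $D^\alpha\circ\cdots\circ D^\alpha$ (with $D^0$ the identity), and $D^\alpha D^\alpha$ is $D^\alpha$ applied twice in succession. A solution of such an equation on $(0,\infty)$ is a real-valued function to which $D^\alpha$ can be applied twice at every $x>0$ and which satisfies the equation at every $x>0$. *)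

theory Defs
  imports Complex_Main
begin

definition has_conf_deriv :: "real \<Rightarrow> (real \<Rightarrow> real) \<Rightarrow> real \<Rightarrow> real \<Rightarrow> bool" where
  "has_conf_deriv \<alpha> f L x \<longleftrightarrow>
     ((\<lambda>\<epsilon>. (f (x + \<epsilon> * x powr (1 - \<alpha>)) - f x) / \<epsilon>) \<longlongrightarrow> L) (at 0)"

definition conf_differentiable :: "real \<Rightarrow> (real \<Rightarrow> real) \<Rightarrow> real \<Rightarrow> bool" where
  "conf_differentiable \<alpha> f x \<longleftrightarrow> (\<exists>L. has_conf_deriv \<alpha> f L x)"

text \<open>The value is meaningful only where \<^term>\<open>conf_differentiable \<alpha> f x\<close> holds and \<open>x > 0\<close>.
  For \<open>x > 0\<close> it depends only on the values of \<open>f\<close> near \<open>x\<close>, so arbitrary values on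
  \<open>x \<le> 0\<close> never influence iterated derivatives at positive points.\<close>

definition conf_deriv :: "real \<Rightarrow> (real \<Rightarrow> real) \<Rightarrow> real \<Rightarrow> real" where
  "conf_deriv \<alpha> f x = Lim (at 0) (\<lambda>\<epsilon>. (f (x + \<epsilon> * x powr (1 - \<alpha>)) - f x) / \<epsilon>)"

definition iter_conf_deriv :: "real \<Rightarrow> nat \<Rightarrow> (real \<Rightarrow> real) \<Rightarrow> (real \<Rightarrow> real)" where
  "iter_conf_deriv \<alpha> m = conf_deriv \<alpha> ^^ m"

definition iter_conf_differentiable :: "real \<Rightarrow> nat \<Rightarrow> (real \<Rightarrow> real) \<Rightarrow> bool" where
  "iter_conf_differentiable \<alpha> m f \<longleftrightarrow>
     (\<forall>k<m. \<forall>x>0. conf_differentiable \<alpha> (iter_conf_deriv \<alpha> k f) x)"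

definition conf_laguerre_solution :: "real \<Rightarrow> nat \<Rightarrow> (real \<Rightarrow> real) \<Rightarrow> bool" where
  "conf_laguerre_solution \<alpha> N S \<longleftrightarrow>
     iter_conf_differentiable \<alpha> 2 S \<and>
     (\<forall>x>0. x powr \<alpha> * conf_deriv \<alpha> (conf_deriv \<alpha> S) x
            + (\<alpha> - x powr \<alpha>) * conf_deriv \<alpha> S x
            + real N * \<alpha> * S x = 0)"

definition conf_assoc_laguerre_solution :: "real \<Rightarrow> nat \<Rightarrow> nat \<Rightarrow> (real \<Rightarrow> real) \<Rightarrow> bool" where
  "conf_assoc_laguerre_solution \<alpha> m n y \<longleftrightarrow>
     iter_conf_differentiable \<alpha> 2 y \<and>
     (\<forall>x>0. x powr \<alpha> * conf_deriv \<alpha> (conf_deriv \<alpha> y) x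
            + (real m * \<alpha> + \<alpha> - x powr \<alpha>) * conf_deriv \<alpha> y x
            + real n * \<alpha> * y x = 0)"

end

theory Submission
  imports Defs
begin

text \<open>At \<open>x > 0\<close> the conformable derivative is \<open>x\<^sup>1\<^sup>-\<^sup>\<alpha> d/dx\<close>, so \<open>D\<^sup>\<alpha> x\<^sup>\<alpha> = \<alpha>\<close>. Solving the associated
  equation with parameters \<open>(m, n + 1)\<close> for the second derivative shows that the latter is again
  differentiable, and applying \<open>D\<^sup>\<alpha>\<close> to the equation gives the one with parameters \<open>(m + 1, n)\<close>
  for \<open>D\<^sup>\<alpha> y\<close>. The case \<open>m = 0\<close> is the Laguerre equation itself.\<close>

text \<open>The substitution \<open>h = \<epsilon> * x powr (1 - \<alpha>)\<close> turns one
  difference quotient into the other, up to a nonzero constant factor.\<close>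

lemma has_conf_deriv_iff_DERIV:
  fixes x :: real
  assumes "x > 0"
  shows "has_conf_deriv \<alpha> f L x \<longleftrightarrow> (f has_real_derivative L * x powr (\<alpha> - 1)) (at x)"
proof -
  define c where "c = x powr (1 - \<alpha>)"
  have c: "c > 0" and inv: "x powr (\<alpha> - 1) = 1 / c"
    using assms by (auto simp: c_def powr_minus_divide [symmetric])
  \<comment> \<open>Scaling preserves the punctured neighbourhoods of 0; \<open>k = 1 / c\<close>
    serves one direction and \<open>k = c\<close> the other.\<close>
  have scale: "filterlim (\<lambda>h. h * k) (at 0) (at 0)" if "k \<noteq> 0" for k :: real
    using that by (auto simp: filterlim_at eventually_at intro!: tendsto_eq_intros exI [of _ 1])
  show ?thesis
  proof
    assume "has_conf_deriv \<alpha> f L x"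
    then have "((\<lambda>\<epsilon>. (f (x + \<epsilon> * c) - f x) / \<epsilon>) \<longlongrightarrow> L) (at 0)"
      by (simp add: has_conf_deriv_def c_def)
    from filterlim_compose [OF this scale [of "1 / c"]]
    have "((\<lambda>h. (f (x + h) - f x) / h * c) \<longlongrightarrow> L) (at 0)"
      using c by simp
    from tendsto_mult [OF this tendsto_const [of "1 / c"]]
    show "(f has_real_derivative L * x powr (\<alpha> - 1)) (at x)"
      using c by (simp add: DERIV_def inv)
  next
    assume "(f has_real_derivative L * x powr (\<alpha> - 1)) (at x)"
    then have "((\<lambda>h. (f (x + h) - f x) / h) \<longlongrightarrow> L / c) (at 0)"
      by (simp add: DERIV_def inv)
    from tendsto_mult [OF filterlim_compose [OF this scale [of c]] tendsto_const [of c]]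
    show "has_conf_deriv \<alpha> f L x"
      using c by (simp add: has_conf_deriv_def flip: c_def)
  qed
qed

lemma conf_deriv_eqI: "has_conf_deriv \<alpha> f L x \<Longrightarrow> conf_deriv \<alpha> f x = L"
  by (simp add: has_conf_deriv_def conf_deriv_def tendsto_Lim)

lemma DERIV_conf_deriv:
  assumes "conf_differentiable \<alpha> f x" "x > 0"
  shows "(f has_real_derivative conf_deriv \<alpha> f x * x powr (\<alpha> - 1)) (at x)"
  using assms conf_deriv_eqI
  by (metis conf_differentiable_def has_conf_deriv_iff_DERIV)

lemma iter_conf_differentiable_2_iff:
  "iter_conf_differentiable \<alpha> 2 f \<longleftrightarrow>
     (\<forall>x>0. conf_differentiable \<alpha> f x \<and> conf_differentiable \<alpha> (conf_deriv \<alpha> f) x)"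
  by (auto simp: iter_conf_differentiable_def iter_conf_deriv_def numeral_2_eq_2 less_Suc_eq)

lemma conf_assoc_laguerre_solution_conf_deriv:
  assumes sol: "conf_assoc_laguerre_solution \<alpha> m (Suc n) y"
  shows "conf_assoc_laguerre_solution \<alpha> (Suc m) n (conf_deriv \<alpha> y)"
proof -
  define z where "z = conf_deriv \<alpha> y"
  define u where "u = conf_deriv \<alpha> z"
  define b where "b = real m * \<alpha> + \<alpha>"
  define k where "k = real (Suc n) * \<alpha>"
  have dy: "conf_differentiable \<alpha> y x" and dz: "conf_differentiable \<alpha> z x" if "x > 0" for x
    using sol that
    by (auto simp: conf_assoc_laguerre_solution_def iter_conf_differentiable_2_iff z_def)
  have u_eq: "u x = - ((b - x powr \<alpha>) * z x + k * y x) / x powr \<alpha>" if "x > 0" for x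
  proof -
    have "x powr \<alpha> * u x + (b - x powr \<alpha>) * z x + k * y x = 0"
      using sol that
      by (auto simp: conf_assoc_laguerre_solution_def z_def u_def b_def k_def)
    then show ?thesis
      using that by (simp add: field_simps)
  qed
  \<comment> \<open>Quotient rule for \<open>u_eq\<close>: the first three terms come from its
    numerator, and \<open>\<alpha> * u x\<close> from its denominator.\<close>
  have u': "has_conf_deriv \<alpha> u
      (- ((b - x powr \<alpha>) * u x - \<alpha> * z x + k * z x + \<alpha> * u x) / x powr \<alpha>) x"
    if x: "x > 0" for x
  proof -
    \<comment> \<open>The ordinary derivatives of \<open>y\<close>, \<open>z\<close> and
      \<open>t powr \<alpha>\<close> at \<open>x\<close> are all multiples of \<open>w\<close>, so
      \<open>w\<close> factors out and leaves the conformable derivative.\<close>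
    define w where "w = x powr (\<alpha> - 1)"
    define A where "A = x powr \<alpha>"
    have A: "A > 0" using x by (simp add: A_def)
    have y': "(y has_real_derivative z x * w) (at x)"
      using DERIV_conf_deriv [OF dy x] x by (simp add: z_def w_def)
    have z': "(z has_real_derivative u x * w) (at x)"
      using DERIV_conf_deriv [OF dz x] x by (simp add: u_def w_def)
    have "((\<lambda>t. - ((b - t powr \<alpha>) * z t + k * y t) / t powr \<alpha>) has_real_derivative
        (- ((b - A) * (u x * w) - \<alpha> * w * z x + k * (z x * w)) * A
          + ((b - A) * z x + k * y x) * (\<alpha> * w)) / (A * A)) (at x)"
      using x unfolding A_def
      by (auto intro!: derivative_eq_intros y' z' simp: w_def algebra_simps)
    \<comment> \<open>Using the equation itself here eliminates \<open>y\<close> and cancels one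
      factor \<open>A\<close>.\<close>
    also have "(b - A) * z x + k * y x = - u x * A"
      using u_eq [OF x] A by (simp add: A_def)
    also have "(- ((b - A) * (u x * w) - \<alpha> * w * z x + k * (z x * w)) * A
          + - u x * A * (\<alpha> * w)) / (A * A)
        = - ((b - A) * u x - \<alpha> * z x + k * z x + \<alpha> * u x) / A * w"
      using A by (simp add: field_simps)
    finally have "(u has_real_derivative
        - ((b - A) * u x - \<alpha> * z x + k * z x + \<alpha> * u x) / A * w) (at x)"
      \<comment> \<open>The formula for \<open>u\<close> is known only on the open half-line, which
        suffices for a derivative at \<open>x\<close>.\<close>
      by (rule has_field_derivative_transform_within_open [where S = "{0<..}"])
        (use x u_eq in auto)
    then show ?thesis
      using x by (simp add: has_conf_deriv_iff_DERIV A_def w_def)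
  qed
  \<comment> \<open>Multiply \<open>u'\<close> by \<open>x powr \<alpha>\<close>: the coefficient of
    \<open>u x\<close> becomes \<open>b + \<alpha> - x powr \<alpha>\<close>, that of
    \<open>z x\<close> becomes \<open>k - \<alpha> = real n * \<alpha>\<close>.\<close>
  have "x powr \<alpha> * conf_deriv \<alpha> u x + (real (Suc m) * \<alpha> + \<alpha> - x powr \<alpha>) * u x
      + real n * \<alpha> * z x = 0" if "x > 0" for x
    using that by (simp add: conf_deriv_eqI [OF u'] b_def k_def field_simps)
  moreover have "iter_conf_differentiable \<alpha> 2 z"
    using dz u' unfolding iter_conf_differentiable_2_iff u_def [symmetric]
    by (auto simp: conf_differentiable_def)
  ultimately show ?thesis
    by (simp add: conf_assoc_laguerre_solution_def u_def flip: z_def)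
qed

text \<open>Each derivative moves one unit from \<open>n\<close> to \<open>m\<close> and keeps
  \<open>n + m\<close> fixed, so the induction must leave \<open>n\<close> arbitrary.\<close>

lemma conf_assoc_laguerre_solution_iter_conf_deriv:
  assumes "conf_laguerre_solution \<alpha> (n + m) S"
  shows "conf_assoc_laguerre_solution \<alpha> m n (iter_conf_deriv \<alpha> m S)"
  using assms
proof (induction m arbitrary: n)
  case 0
  then show ?case
    by (simp add: conf_laguerre_solution_def conf_assoc_laguerre_solution_def iter_conf_deriv_def)
next
  case (Suc m)
  then show ?case
    using conf_assoc_laguerre_solution_conf_deriv [OF Suc.IH [of "Suc n"]]
    by (simp add: iter_conf_deriv_def)
qed

theorem mainTheorem5:
  fixes \<alpha> :: real and m n :: nat and S :: "real \<Rightarrow> real"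
  assumes "0 < \<alpha>" and "\<alpha> \<le> 1"
    and "conf_laguerre_solution \<alpha> (n + m) S"
  shows "iter_conf_differentiable \<alpha> m S \<and>
         conf_assoc_laguerre_solution \<alpha> m n (iter_conf_deriv \<alpha> m S)"
proof
  show "conf_assoc_laguerre_solution \<alpha> m n (iter_conf_deriv \<alpha> m S)"
    using assms(3) by (rule conf_assoc_laguerre_solution_iter_conf_deriv)
  have "conf_differentiable \<alpha> (iter_conf_deriv \<alpha> k S) x" if "k < m" "x > 0" for k x
  proof -
    \<comment> \<open>Splitting the same order at \<open>k\<close> makes the intermediate iterate a
      solution of an associated equation too, hence differentiable.\<close>
    have "conf_laguerre_solution \<alpha> ((n + m - k) + k) S"
      using assms(3) \<open>k < m\<close> by simp
    from conf_assoc_laguerre_solution_iter_conf_deriv [OF this] show ?thesis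
      using \<open>x > 0\<close>
      by (simp add: conf_assoc_laguerre_solution_def iter_conf_differentiable_2_iff)
  qed
  then show "iter_conf_differentiable \<alpha> m S"
    by (simp add: iter_conf_differentiable_def)
qed

end
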